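(* Let $n\ge 1$. The map $w\mapsto (Q(w),\phi_w^{-1}(n))$ is a bijection between the set of simple walks of length $n$ and the set of quantile pairs $(v,k)$ with $v$ having length $n$.
   Context: Intervals $[a,b]$, $[a,b)$ denote intervals of integers. A simple walk of length $n$ is a function $w:[0,n]\to\mathbb Z$ with $w(0)=0$ and $x_i:=w(i)-w(i-1)\in\{+1,-1\}$ for all $i\in[1,n]$. The quantile permutation $\phi_w$ of a walk $w$ of length $n$ is the unique permutation of $[1,n]$ such that $(w(\phi_w(1)-1),\phi_w(1)-1),\dots,(w(\phi_w(n)-1),\phi_w(n)-1)$ is the increasing lexicographic reordering of $(w(0),0),(w(1),1),\dots,(w(n-1),n-1)$. The quantile transform of $w$ is the walk $Q(w)$ of length $n$ with $Q(w)(0)=0$ and $Q(w)(j)=\sum_{i=1}^j x_{\phi_w(i)}$ for $j\in[1,n]$. A quantile walk is a simple walk $v$ of some length $n$ that is either non-negative ($v(j)\ge 0$ for all $j\in[0,n]$) or a first-passage bridge to a negative value ($v(n)<0$ and $v(j)\neq v(n)$ for all $j<n$). A quantile pair is a pair $(v,k)$ where $v$ is a quantile walk of length $n\ge1$ and $k$ is an integer with $1\le k\le n$ such that $v(j)\ge 0$ for $j\in[0,k)$ and $v(j)>v(n)$ for $j\in[k,n)$. *)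

theory Defs
  imports "HOL-Library.FuncSet" "HOL-Library.Product_Lexorder" "HOL-Combinatorics.Permutations"
begin

text \<open>A walk of length \<open>n\<close> is a function on the integer interval \<open>[0,n]\<close>; it is encoded as a
  function that is extensional on \<open>{0..n}\<close>, so that equality of walks is equality on \<open>[0,n]\<close>.\<close>

definition simple_walks :: "nat \<Rightarrow> (nat \<Rightarrow> int) set" where
  "simple_walks n =
    {w \<in> {0..n} \<rightarrow>\<^sub>E UNIV. w 0 = 0 \<and> (\<forall>i\<in>{1..n}. w i - w (i - 1) \<in> {1, -1})}"

text \<open>The order on \<open>int \<times> nat\<close> is the lexicographic one. The pairs \<open>(w j, j)\<close> are pairwise distinct,
  so their increasing rearrangement is strictly increasing.\<close>

definition quantile_perm :: "nat \<Rightarrow> (nat \<Rightarrow> int) \<Rightarrow> nat \<Rightarrow> nat" where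
  "quantile_perm n w =
    (THE p. p permutes {1..n} \<and> strict_mono_on {1..n} (\<lambda>i. (w (p i - 1), p i - 1)))"

definition quantile_transform :: "nat \<Rightarrow> (nat \<Rightarrow> int) \<Rightarrow> nat \<Rightarrow> int" where
  "quantile_transform n w =
    (\<lambda>j\<in>{0..n}. \<Sum>i = 1..j. w (quantile_perm n w i) - w (quantile_perm n w i - 1))"

definition nonnegative_walk :: "nat \<Rightarrow> (nat \<Rightarrow> int) \<Rightarrow> bool" where
  "nonnegative_walk n v \<longleftrightarrow> (\<forall>j\<in>{0..n}. 0 \<le> v j)"

definition negative_first_passage_bridge :: "nat \<Rightarrow> (nat \<Rightarrow> int) \<Rightarrow> bool" where
  "negative_first_passage_bridge n v \<longleftrightarrow> v n < 0 \<and> (\<forall>j<n. v j \<noteq> v n)"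

definition quantile_walks :: "nat \<Rightarrow> (nat \<Rightarrow> int) set" where
  "quantile_walks n =
    {v \<in> simple_walks n. nonnegative_walk n v \<or> negative_first_passage_bridge n v}"

definition quantile_pairs :: "nat \<Rightarrow> ((nat \<Rightarrow> int) \<times> nat) set" where
  "quantile_pairs n =
    {(v, k). 1 \<le> n \<and> v \<in> quantile_walks n \<and> 1 \<le> k \<and> k \<le> n \<and>
      (\<forall>j\<in>{0..<k}. 0 \<le> v j) \<and> (\<forall>j\<in>{k..<n}. v n < v j)}"

end

theory Submission
  imports Defs
begin

text \<open>The inverse of the quantile permutation ranks the steps of \<open>w\<close>, ordered by starting level and then
  by time, so \<open>Q(w)\<close> is a concatenation of blocks, one for each level. The walk is recovered from the
  boundaries of the blocks. These are determined by \<open>(Q(w), k)\<close>, because \<open>k\<close> is the end of the block of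
  the level \<open>L\<close> of the last step, the last exit from a visited level is a down step above \<open>L\<close> and an up
  step below \<open>L\<close>, and a discrete Tanaka formula counts the down steps of a block. Hence the map is
  injective. It is surjective by counting: cutting \<open>v\<close> at \<open>k\<close> and exchanging the two pieces maps
  quantile pairs injectively to walks (a Vervaat transform).\<close>

section \<open>Ranks in a finite set\<close>

definition rank_on :: "'a set \<Rightarrow> ('a \<Rightarrow> 'b::linorder) \<Rightarrow> 'a \<Rightarrow> nat" where
  "rank_on A f i = card {j \<in> A. f j \<le> f i}"

lemma rank_on_less_iff:
  assumes "finite A" "i \<in> A" "j \<in> A"
  shows "rank_on A f i < rank_on A f j \<longleftrightarrow> f i < f j"
proof -
  let ?B = "\<lambda>x. {k \<in> A. f k \<le> f x}"
  have fin: "finite (?B x)" for x using assms(1) by simp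
  have sub: "?B x \<subseteq> ?B y" if "f x \<le> f y" for x y
    using order_trans[OF _ that] by blast
  have le: "rank_on A f x \<le> rank_on A f y" if "f x \<le> f y" for x y
    unfolding rank_on_def by (rule card_mono[OF fin sub[OF that]])
  have less: "rank_on A f i < rank_on A f j" if "f i < f j"
  proof -
    have "j \<in> ?B j" "j \<notin> ?B i" using assms(3) that by simp_all
    then have "?B i \<subset> ?B j" using sub[OF less_imp_le[OF that]] by blast
    then show ?thesis
      unfolding rank_on_def by (rule psubset_card_mono[OF fin])
  qed
  show ?thesis
  proof
    assume "rank_on A f i < rank_on A f j"
    then have "\<not> f j \<le> f i" using le[of j i] by linarith
    then show "f i < f j" by simp
  qed (rule less)
qed

lemma rank_on_le_iff:
  assumes "finite A" "i \<in> A" "j \<in> A"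
  shows "rank_on A f i \<le> rank_on A f j \<longleftrightarrow> f i \<le> f j"
  unfolding not_less[symmetric] rank_on_less_iff[OF assms(1,3,2)] by (rule refl)

lemma bij_betw_rank_on:
  assumes "finite A" "inj_on f A"
  shows "bij_betw (rank_on A f) A {1..card A}"
proof -
  have inj: "inj_on (rank_on A f) A"
  proof (rule inj_onI)
    fix x y assume xy: "x \<in> A" "y \<in> A" "rank_on A f x = rank_on A f y"
    then have "f x \<le> f y" "f y \<le> f x"
      using rank_on_le_iff[OF assms(1)] by (metis order_refl)+
    then show "x = y" using assms(2) xy by (auto dest: inj_onD)
  qed
  have "rank_on A f ` A \<subseteq> {1..card A}"
    using assms(1)
    by (auto simp: rank_on_def Suc_le_eq card_gt_0_iff intro: card_mono)
  then have "rank_on A f ` A = {1..card A}"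
    by (intro card_subset_eq) (simp_all add: card_image inj)
  with inj show ?thesis by (simp add: bij_betw_def)
qed

section \<open>The quantile permutation and its inverse\<close>

definition time_key :: "(nat \<Rightarrow> int) \<Rightarrow> nat \<Rightarrow> int \<times> nat" where
  "time_key w i = (w (i - 1), i - 1)"

text \<open>On \<open>{1..n}\<close> this is the inverse of \<open>quantile_perm n w\<close>; being
  a count, it is easier to handle than the definite description.\<close>

definition step_rank :: "nat \<Rightarrow> (nat \<Rightarrow> int) \<Rightarrow> nat \<Rightarrow> nat" where
  "step_rank n w = rank_on {1..n} (time_key w)"

lemma time_key_le_iff:
  assumes "1 \<le> i" "1 \<le> j"
  shows "time_key w i \<le> time_key w j
    \<longleftrightarrow> w (i - 1) < w (j - 1) \<or> w (i - 1) = w (j - 1) \<and> i \<le> j"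
  using assms by (auto simp: time_key_def)

lemma step_rank_less_iff:
  assumes "i \<in> {1..n}" "j \<in> {1..n}"
  shows "step_rank n w i < step_rank n w j \<longleftrightarrow> time_key w i < time_key w j"
  unfolding step_rank_def by (rule rank_on_less_iff[OF finite_atLeastAtMost assms])

lemma step_rank_le_iff:
  assumes "i \<in> {1..n}" "j \<in> {1..n}"
  shows "step_rank n w i \<le> step_rank n w j
    \<longleftrightarrow> w (i - 1) < w (j - 1) \<or> w (i - 1) = w (j - 1) \<and> i \<le> j"
  unfolding step_rank_def rank_on_le_iff[OF finite_atLeastAtMost assms]
  using assms by (intro time_key_le_iff) simp_all

lemma bij_betw_step_rank: "bij_betw (step_rank n w) {1..n} {1..n}"
proof -
  have "inj_on (time_key w) {1..n}"
    by (rule inj_onI) (auto simp: time_key_def)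
  from bij_betw_rank_on[OF finite_atLeastAtMost this] show ?thesis
    by (simp only: card_atLeastAtMost diff_Suc_1 step_rank_def)
qed

lemma step_rank_in: "i \<in> {1..n} \<Longrightarrow> step_rank n w i \<in> {1..n}"
  using bij_betw_step_rank by (rule bij_betwE[THEN bspec])

text \<open>If \<open>p\<close> lists the keys increasingly, exactly \<open>p 1\<close>, ...,
  \<open>p j\<close> have keys up to that of \<open>p j\<close>. So every sorting permutation
  inverts \<open>step_rank\<close>, which yields uniqueness.\<close>

lemma quantile_perm_unique:
  assumes "p permutes {1..n}" "strict_mono_on {1..n} (\<lambda>i. time_key w (p i))" "j \<in> {1..n}"
  shows "step_rank n w (p j) = j"
proof -
  have "{i \<in> {1..n}. time_key w i \<le> time_key w (p j)} = p ` {1..j}"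
  proof (intro equalityI subsetI)
    fix i assume i: "i \<in> {i \<in> {1..n}. time_key w i \<le> time_key w (p j)}"
    then obtain k where k: "k \<in> {1..n}" "i = p k"
      using permutes_image[OF assms(1)] by (metis (no_types, lifting) imageE mem_Collect_eq)
    have "k \<le> j"
      using i k assms(3) strict_mono_on_less_eq[OF assms(2), of k j] by auto
    with k show "i \<in> p ` {1..j}" by auto
  next
    fix i assume "i \<in> p ` {1..j}"
    then obtain k where k: "i = p k" "k \<in> {1..j}" by auto
    then have "p k \<in> {1..n}"
      using assms(3) permutes_in_image[OF assms(1), of k] by auto
    moreover have "time_key w (p k) \<le> time_key w (p j)"
      using k assms(3) strict_mono_on_less_eq[OF assms(2), of k j] by auto
    ultimately show "i \<in> {i \<in> {1..n}. time_key w i \<le> time_key w (p j)}"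
      using k by simp
  qed
  then have "step_rank n w (p j) = card (p ` {1..j})" by (simp add: step_rank_def rank_on_def)
  also have "\<dots> = j"
    by (simp add: card_image permutes_inj_on[OF assms(1)])
  finally show ?thesis .
qed

lemma quantile_perm:
  "quantile_perm n w permutes {1..n}"
  "strict_mono_on {1..n} (\<lambda>i. time_key w (quantile_perm n w i))"
proof -
  \<comment> \<open>\<open>step_rank\<close> is extended by the identity, as \<open>permutes\<close>
    demands; the inverse of \<open>q\<close> is the witness.\<close>
  define q where "q i = (if i \<in> {1..n} then step_rank n w i else i)" for i
  have q: "q permutes {1..n}"
  proof (rule bij_imp_permutes)
    have "bij_betw q {1..n} {1..n} = bij_betw (step_rank n w) {1..n} {1..n}"
      by (rule bij_betw_cong) (simp add: q_def)
    then show "bij_betw q {1..n} {1..n}" using bij_betw_step_rank by simp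
  qed (simp only: q_def if_False)
  let ?P = "\<lambda>p. p permutes {1..n} \<and> strict_mono_on {1..n} (\<lambda>i. time_key w (p i))"
  have iq: "inv q permutes {1..n}" using q by (rule permutes_inv)
  have "?P (inv q)"
  proof (intro conjI iq strict_mono_onI)
    fix r s assume rs: "r \<in> {1..n}" "s \<in> {1..n}" "r < s"
    have m: "inv q r \<in> {1..n}" "inv q s \<in> {1..n}"
      using rs permutes_in_image[OF iq] by blast+
    have "q (inv q r) < q (inv q s)" using rs(3) permutes_inverses(1)[OF q] by simp
    then have "step_rank n w (inv q r) < step_rank n w (inv q s)"
      using m by (simp only: q_def if_True)
    then show "time_key w (inv q r) < time_key w (inv q s)"
      using step_rank_less_iff[OF m] by blast
  qed
  moreover have "p = inv q" if "?P p" for p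
  proof
    from that have pp: "p permutes {1..n}"
      and pm: "strict_mono_on {1..n} (\<lambda>i. time_key w (p i))" by simp_all
    fix j
    show "p j = inv q j"
    proof (cases "j \<in> {1..n}")
      case True
      then have "p j \<in> {1..n}" using permutes_in_image[OF pp] by simp
      moreover have "step_rank n w (p j) = j"
        using pp pm True by (rule quantile_perm_unique)
      ultimately have "q (p j) = j" by (simp only: q_def if_True)
      then show ?thesis using permutes_inverses(2)[OF q, of "p j"] by simp
    next
      case False
      then show ?thesis using permutes_not_in[OF pp False] permutes_not_in[OF iq False] by simp
    qed
  qed
  ultimately have "?P (quantile_perm n w)"
    unfolding quantile_perm_def time_key_def[symmetric] by (rule theI)
  then show "quantile_perm n w permutes {1..n}"
    "strict_mono_on {1..n} (\<lambda>i. time_key w (quantile_perm n w i))" by blast+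
qed

lemma step_rank_quantile_perm:
  "j \<in> {1..n} \<Longrightarrow> step_rank n w (quantile_perm n w j) = j"
  by (rule quantile_perm_unique[OF quantile_perm])

lemma inv_quantile_perm:
  assumes "i \<in> {1..n}"
  shows "inv (quantile_perm n w) i = step_rank n w i"
proof -
  let ?p = "quantile_perm n w"
  have "inv ?p i \<in> {1..n}"
    using assms permutes_in_image[OF permutes_inv[OF quantile_perm(1)]] by blast
  from step_rank_quantile_perm[OF this, of w] show ?thesis
    unfolding permutes_inverses(1)[OF quantile_perm(1)] by (rule sym)
qed

section \<open>Steps of the quantile transform\<close>

text \<open>Reindexing by the time of a step instead of its position makes the permutation
  disappear.\<close>

lemma quantile_transform_eq:
  assumes "j \<le> n"
  shows "quantile_transform n w j = (\<Sum>i | i \<in> {1..n} \<and> step_rank n w i \<le> j. w i - w (i - 1))"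
proof -
  let ?p = "quantile_perm n w"
  have "(\<Sum>i | i \<in> {1..n} \<and> step_rank n w i \<le> j. w i - w (i - 1))
      = (\<Sum>i = 1..j. w (?p i) - w (?p i - 1))"
  proof (rule sum.reindex_bij_witness[where i = ?p and j = "step_rank n w"])
    fix i assume i: "i \<in> {i. i \<in> {1..n} \<and> step_rank n w i \<le> j}"
    then have "inv ?p i = step_rank n w i" by (intro inv_quantile_perm) blast
    then show "?p (step_rank n w i) = i"
      using permutes_inverses(1)[OF quantile_perm(1)] by metis
    then show "w (?p (step_rank n w i)) - w (?p (step_rank n w i) - 1) = w i - w (i - 1)" by simp
    show "step_rank n w i \<in> {1..j}" using i step_rank_in[of i n w] by auto
  next
    fix i assume i: "i \<in> {1..j}"
    with assms have i': "i \<in> {1..n}" by auto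
    show r: "step_rank n w (?p i) = i" using i' by (rule step_rank_quantile_perm)
    have "?p i \<in> {1..n}" using i' permutes_in_image[OF quantile_perm(1)] by blast
    then show "?p i \<in> {i. i \<in> {1..n} \<and> step_rank n w i \<le> j}" using r i by simp
  qed
  then show ?thesis using assms by (simp add: quantile_transform_def)
qed

text \<open>Ranks are distinct, so raising the threshold by 1 to the rank of \<open>i\<close> admits
  step \<open>i\<close> alone.\<close>

lemma quantile_transform_step:
  assumes "i \<in> {1..n}"
  shows "quantile_transform n w (step_rank n w i) - quantile_transform n w (step_rank n w i - 1)
    = w i - w (i - 1)"
proof -
  let ?r = "step_rank n w"
  have r: "?r i \<in> {1..n}" using assms by (rule step_rank_in)
  have *: "i' = i" if "?r i' = ?r i" "i' \<in> {1..n}" for i'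
    using that assms bij_betw_step_rank[of n w] by (meson bij_betw_imp_inj_on inj_onD)
  have **: "{i'. i' \<in> {1..n} \<and> ?r i' \<le> ?r i} = insert i {i'. i' \<in> {1..n} \<and> ?r i' \<le> ?r i - 1}"
  proof -
    have "?r i' \<le> ?r i \<longleftrightarrow> i' = i \<or> ?r i' \<le> ?r i - 1" if "i' \<in> {1..n}" for i'
    proof -
      have "?r i' = ?r i \<longleftrightarrow> i' = i" using that * by blast
      then show ?thesis using r by auto
    qed
    then show ?thesis using assms by blast
  qed
  have ni: "i \<notin> {i'. i' \<in> {1..n} \<and> ?r i' \<le> ?r i - 1}" using r by auto
  have "?r i \<le> n" "?r i - 1 \<le> n" using r by auto
  note eq = this[THEN quantile_transform_eq, of w]
  have fin: "finite {i'. i' \<in> {1..n} \<and> ?r i' \<le> ?r i - 1}" by simp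
  show ?thesis
    unfolding eq ** sum.insert[OF fin ni] by simp
qed

lemma simple_walk_step:
  assumes "w \<in> simple_walks n" "i \<in> {1..n}"
  shows "w i - w (i - 1) = 1 \<or> w i - w (i - 1) = -1"
  using assms by (auto simp: simple_walks_def)

lemma simple_walk_Suc:
  assumes "w \<in> simple_walks n" "i < n"
  shows "w (Suc i) = w i + 1 \<or> w (Suc i) = w i - 1"
  using simple_walk_step[OF assms(1), of "Suc i"] assms(2) by auto

lemma sum_increments:
  fixes f :: "nat \<Rightarrow> int"
  shows "(\<Sum>i\<in>{1..n}. f i - f (i - 1)) = f n - f 0"
  by (induction n) auto

lemma quantile_transform_end:
  assumes "w \<in> simple_walks n"
  shows "quantile_transform n w n = w n"
proof -
  have "step_rank n w i \<le> n" if "i \<in> {1..n}" for i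
    using step_rank_in[OF that, of w] by simp
  then have *: "{i. i \<in> {1..n} \<and> step_rank n w i \<le> n} = {1..n}" by blast
  have "w 0 = 0" using assms by (simp add: simple_walks_def)
  then show ?thesis
    unfolding quantile_transform_eq[OF order_refl] * sum_increments by simp
qed

lemma quantile_transform_simple_walk:
  assumes "w \<in> simple_walks n"
  shows "quantile_transform n w \<in> simple_walks n"
proof -
  have "quantile_transform n w j - quantile_transform n w (j - 1) \<in> {1, -1}" if "j \<in> {1..n}" for j
  proof -
    let ?i = "quantile_perm n w j"
    have i: "?i \<in> {1..n}" using that permutes_in_image[OF quantile_perm(1)] by blast
    show ?thesis
      using quantile_transform_step[OF i, of w] simple_walk_step[OF assms i]
        step_rank_quantile_perm[OF that, of w] by simp
  qed
  then show ?thesis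
    by (auto simp: simple_walks_def quantile_transform_def)
qed

text \<open>Take the last time at which \<open>f\<close> is at least \<open>a\<close>. The next
  value is below \<open>a\<close>, and a drop of at most 1 forces the exit to start exactly at
  \<open>a\<close>.\<close>

lemma last_exit:
  fixes f :: "nat \<Rightarrow> int"
  assumes "\<And>i. i < m \<Longrightarrow> f i - 1 \<le> f (Suc i)" "e \<le> m" "a \<le> f e" "f m < a"
  obtains i where "e \<le> i" "i < m" "f i = a" "f (Suc i) = a - 1" "\<And>j. i < j \<Longrightarrow> j \<le> m \<Longrightarrow> f j < a"
proof -
  define i where "i = Max {j. j \<le> m \<and> a \<le> f j}"
  have i: "i \<in> {j. j \<le> m \<and> a \<le> f j}"
    unfolding i_def using assms by (intro Max_in) auto
  have ge: "j \<le> i" if "j \<le> m" "a \<le> f j" for j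
    unfolding i_def using that by (intro Max_ge) auto
  have after: "f j < a" if "i < j" "j \<le> m" for j
    using ge[of j] that by force
  have "i < m" using i assms(4) by (metis (mono_tags, lifting) le_neq_implies_less mem_Collect_eq not_less)
  with after[of "Suc i"] assms(1)[of i] i have "f i = a" "f (Suc i) = a - 1" by auto
  with \<open>i < m\<close> show ?thesis using that ge[OF assms(2,3)] after by blast
qed


section \<open>Blocks of steps leaving the same level\<close>

text \<open>The steps leaving level \<open>a\<close> occupy the positions
  \<open>level_start n w a + 1\<close> to \<open>level_start n w (a + 1)\<close> of
  \<open>Q(w)\<close>.\<close>

definition level_start :: "nat \<Rightarrow> (nat \<Rightarrow> int) \<Rightarrow> int \<Rightarrow> nat" where
  "level_start n w a = card {i \<in> {1..n}. w (i - 1) < a}"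

lemma level_start_le: "level_start n w a \<le> n"
proof -
  have "level_start n w a \<le> card {1..n}"
    unfolding level_start_def by (intro card_mono) auto
  then show ?thesis by simp
qed

text \<open>Up to step \<open>i\<close> come all lower levels, then the visits to its own level so
  far. The second summand depends only on \<open>w\<close> before time \<open>i\<close>, so
  \<open>w\<close> can be recovered step by step from the block boundaries.\<close>

lemma step_rank_eq_level_start:
  assumes "i \<in> {1..n}"
  shows "step_rank n w i =
    level_start n w (w (i - 1)) + card {j \<in> {1..i}. w (j - 1) = w (i - 1)}"
proof -
  have "{j \<in> {1..n}. time_key w j \<le> time_key w i} =
    {j \<in> {1..n}. w (j - 1) < w (i - 1)} \<union> {j \<in> {1..i}. w (j - 1) = w (i - 1)}"
    using assms time_key_le_iff[of _ i w] by auto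
  then have "step_rank n w i =
    card ({j \<in> {1..n}. w (j - 1) < w (i - 1)} \<union> {j \<in> {1..i}. w (j - 1) = w (i - 1)})"
    by (simp only: step_rank_def rank_on_def)
  also have "\<dots> = level_start n w (w (i - 1)) + card {j \<in> {1..i}. w (j - 1) = w (i - 1)}"
    unfolding level_start_def by (intro card_Un_disjoint) auto
  finally show ?thesis .
qed

lemma step_rank_le_level_start_iff:
  assumes "i \<in> {1..n}"
  shows "step_rank n w i \<le> level_start n w a \<longleftrightarrow> w (i - 1) < a"
proof
  assume "w (i - 1) < a"
  then show "step_rank n w i \<le> level_start n w a"
    unfolding step_rank_def rank_on_def level_start_def
    by (intro card_mono) (auto simp: time_key_def)
next
  assume le: "step_rank n w i \<le> level_start n w a"
  have i: "i \<in> {j \<in> {1..i}. w (j - 1) = w (i - 1)}" using assms by simp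
  have "card {j \<in> {1..i}. w (j - 1) = w (i - 1)} \<noteq> 0"
  proof
    assume "card {j \<in> {1..i}. w (j - 1) = w (i - 1)} = 0"
    then have "{j \<in> {1..i}. w (j - 1) = w (i - 1)} = {}" by simp
    with i show False by blast
  qed
  then have "level_start n w (w (i - 1)) < level_start n w a"
    using le step_rank_eq_level_start[OF assms, of w] by linarith
  moreover have "level_start n w a \<le> level_start n w (w (i - 1))" if "a \<le> w (i - 1)"
    unfolding level_start_def using that by (intro card_mono) auto
  ultimately show "w (i - 1) < a" by linarith
qed

lemma step_rank_last_visit:
  assumes "i \<in> {1..n}" "w (i - 1) < a"
    and "\<And>j. j \<in> {1..n} \<Longrightarrow> w (j - 1) < a \<Longrightarrow> w (j - 1) < w (i - 1) \<or> w (j - 1) = w (i - 1) \<and> j \<le> i"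
  shows "step_rank n w i = level_start n w a"
proof -
  have "{j \<in> {1..n}. time_key w j \<le> time_key w i} = {j \<in> {1..n}. w (j - 1) < a}"
    using assms time_key_le_iff[of _ i w] by auto
  then show ?thesis by (simp only: step_rank_def rank_on_def level_start_def)
qed

text \<open>By a discrete Tanaka formula, the number \<open>d\<close> of down steps leaving level \<open>a\<close> satisfies
  \<open>v (t a) = min (w n) a - min 0 a + d\<close>. Also \<open>2 d\<close> is the length of the block of level \<open>a\<close> minus the
  increment of \<open>v\<close> over it; the identity below results from eliminating \<open>d\<close>.\<close>

lemma quantile_transform_level_start:
  assumes "w \<in> simple_walks n"
  defines "v \<equiv> quantile_transform n w" and "t \<equiv> level_start n w"
  shows "v (t a) + int (t a) = int (t (a + 1)) - v (t (a + 1)) + 2 * (min (w n) a - min 0 a)"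
proof -
  let ?S = "\<lambda>b. {i \<in> {1..n}. w (i - 1) < b}"
  have v: "v (t b) = (\<Sum>i\<in>{1..n}. if w (i - 1) < b then w i - w (i - 1) else 0)" for b
  proof -
    have *: "{i. i \<in> {1..n} \<and> step_rank n w i \<le> level_start n w b} = ?S b"
      using step_rank_le_level_start_iff by blast
    have "v (t b) = (\<Sum>i\<in>?S b. w i - w (i - 1))"
      unfolding v_def t_def quantile_transform_eq[OF level_start_le] * ..
    also have "\<dots> = (\<Sum>i\<in>{1..n}. if w (i - 1) < b then w i - w (i - 1) else 0)"
      by (rule sum.inter_filter) simp
    finally show ?thesis .
  qed
  have t: "int (t b) = (\<Sum>i\<in>{1..n}. if w (i - 1) < b then 1 else 0)" for b
  proof -
    have "int (t b) = (\<Sum>i\<in>?S b. 1)" by (simp add: t_def level_start_def)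
    also have "\<dots> = (\<Sum>i\<in>{1..n}. if w (i - 1) < b then 1 else 0)"
      by (rule sum.inter_filter) simp
    finally show ?thesis .
  qed
  have w0: "w 0 = 0" using assms(1) by (simp add: simple_walks_def)
  have "v (t a) + int (t a) - (int (t (a + 1)) - v (t (a + 1)))
      = (\<Sum>i\<in>{1..n}. (if w (i - 1) < a then w i - w (i - 1) else 0) + (if w (i - 1) < a then 1 else 0)
        - ((if w (i - 1) < a + 1 then 1 else 0) - (if w (i - 1) < a + 1 then w i - w (i - 1) else 0)))"
    unfolding v t sum.distrib sum_subtractf ..
  \<comment> \<open>Below \<open>a\<close> both summands are twice the step; at \<open>a\<close>
    they are \<open>-2\<close> for a down step and \<open>0\<close> for an up step; above
    \<open>a\<close> both vanish.\<close>
  also have "\<dots> = (\<Sum>i\<in>{1..n}. 2 * min (w i) a - 2 * min (w (i - 1)) a)"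
  proof (rule sum.cong[OF refl])
    fix i assume "i \<in> {1..n}"
    from simple_walk_step[OF assms(1) this]
    show "(if w (i - 1) < a then w i - w (i - 1) else 0) + (if w (i - 1) < a then 1 else 0)
        - ((if w (i - 1) < a + 1 then 1 else 0) - (if w (i - 1) < a + 1 then w i - w (i - 1) else 0))
      = 2 * min (w i) a - 2 * min (w (i - 1)) a"
      by (auto simp: min_def)
  qed
  also have "\<dots> = 2 * min (w n) a - 2 * min 0 a"
    using sum_increments[of "\<lambda>i. 2 * min (w i) a" n] w0 by simp
  finally show ?thesis by simp
qed

section \<open>Images are quantile pairs\<close>

text \<open>The value just before step \<open>e\<close> is compared with the telescoping increments
  of \<open>min (w j) a\<close>. They differ only at steps leaving \<open>a\<close>: by 1 for each
  up step before \<open>e\<close> and each down step from \<open>e\<close> on. One of the latter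
  makes the bound strict.\<close>

lemma quantile_transform_lower_bound:
  assumes "w \<in> simple_walks n" "e \<in> {1..n}"
  defines "a \<equiv> w (e - 1)"
  shows "min (w n) a - min 0 a \<le> quantile_transform n w (step_rank n w e - 1)"
    and "i \<in> {e..n} \<Longrightarrow> w (i - 1) = a \<Longrightarrow> w i = a - 1
      \<Longrightarrow> min (w n) a - min 0 a < quantile_transform n w (step_rank n w e - 1)"
proof -
  let ?d = "\<lambda>j. (if w (j - 1) < a \<or> w (j - 1) = a \<and> j < e then w j - w (j - 1) else 0)
    - (min (w j) a - min (w (j - 1)) a)"
  have w0: "w 0 = 0" using assms(1) by (simp add: simple_walks_def)
  have r: "step_rank n w e \<in> {1..n}" using assms(2) by (rule step_rank_in)
  have "step_rank n w j \<le> step_rank n w e - 1 \<longleftrightarrow> w (j - 1) < a \<or> w (j - 1) = a \<and> j < e"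
    if "j \<in> {1..n}" for j
  proof -
    have "step_rank n w j \<le> step_rank n w e - 1 \<longleftrightarrow> \<not> step_rank n w e \<le> step_rank n w j"
      using r by auto
    then show ?thesis
      unfolding step_rank_le_iff[OF assms(2) that] a_def by auto
  qed
  then have *: "{j. j \<in> {1..n} \<and> step_rank n w j \<le> step_rank n w e - 1}
    = {j \<in> {1..n}. w (j - 1) < a \<or> w (j - 1) = a \<and> j < e}" by blast
  have "step_rank n w e - 1 \<le> n" using r by auto
  from quantile_transform_eq[OF this, of w]
  have "quantile_transform n w (step_rank n w e - 1)
    = (\<Sum>j\<in>{j \<in> {1..n}. w (j - 1) < a \<or> w (j - 1) = a \<and> j < e}. w j - w (j - 1))"
    unfolding * .
  also have "\<dots> = (\<Sum>j\<in>{1..n}. if w (j - 1) < a \<or> w (j - 1) = a \<and> j < e then w j - w (j - 1) else 0)"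
    by (rule sum.inter_filter) simp
  also have "\<dots> = (\<Sum>j\<in>{1..n}. ?d j) + (min (w n) a - min 0 a)"
    using sum_increments[of "\<lambda>j. min (w j) a" n] w0 unfolding sum_subtractf by simp
  finally have eq: "quantile_transform n w (step_rank n w e - 1)
    = (\<Sum>j\<in>{1..n}. ?d j) + (min (w n) a - min 0 a)" .
  have nonneg: "0 \<le> ?d j" if "j \<in> {1..n}" for j
    using simple_walk_step[OF assms(1) that] by (auto simp: min_def)
  then have "0 \<le> (\<Sum>j\<in>{1..n}. ?d j)" by (rule sum_nonneg)
  with eq show "min (w n) a - min 0 a \<le> quantile_transform n w (step_rank n w e - 1)" by linarith
  assume i: "i \<in> {e..n}" "w (i - 1) = a" "w i = a - 1"
  have "0 < (\<Sum>j\<in>{1..n}. ?d j)"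
  proof (rule sum_pos2[where i = i])
    show "i \<in> {1..n}" using i assms(2) by auto
    show "0 < ?d i" using i by (simp add: min_def)
  qed (use nonneg in auto)
  with eq show "min (w n) a - min 0 a < quantile_transform n w (step_rank n w e - 1)" by linarith
qed

text \<open>The inequalities of the pair already make \<open>v\<close> a quantile walk: if
  \<open>v n < 0\<close>, all earlier values exceed \<open>v n\<close>; otherwise all values are
  nonnegative.\<close>

lemma quantile_pairsI:
  assumes "v \<in> simple_walks n" "1 \<le> k" "k \<le> n"
    and "\<And>j. j < k \<Longrightarrow> 0 \<le> v j" "\<And>j. k \<le> j \<Longrightarrow> j < n \<Longrightarrow> v n < v j"
  shows "(v, k) \<in> quantile_pairs n"
proof -
  have "v n < v j" if "v n < 0" "j < n" for j
    using that assms(4,5)[of j] by (cases "j < k") auto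
  moreover have "0 \<le> v j" if "0 \<le> v n" "j \<le> n" for j
    using that assms(4,5)[of j] by (cases "j < k"; cases "j = n") auto
  ultimately have "nonnegative_walk n v \<or> negative_first_passage_bridge n v"
    unfolding nonnegative_walk_def negative_first_passage_bridge_def
    by (cases "v n < 0") fastforce+
  with assms show ?thesis by (simp add: quantile_pairs_def quantile_walks_def)
qed

lemma quantile_transform_in_quantile_pairs:
  assumes w: "w \<in> simple_walks n" and "1 \<le> n"
  shows "(quantile_transform n w, step_rank n w n) \<in> quantile_pairs n"
proof (rule quantile_pairsI)
  let ?v = "quantile_transform n w" and ?k = "step_rank n w n"
  define L where "L = w (n - 1)"
  have n: "n \<in> {1..n}" using assms(2) by simp
  show "?v \<in> simple_walks n" using w by (rule quantile_transform_simple_walk)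
  show "1 \<le> ?k" "?k \<le> n" using step_rank_in[OF n, of w] by auto
  have wn: "w n - L = 1 \<or> w n - L = -1" unfolding L_def using w n by (rule simple_walk_step)
  have obt: "\<exists>e\<in>{1..n}. step_rank n w e = Suc j" if "j < n" for j
  proof -
    have "Suc j \<in> step_rank n w ` {1..n}"
      using bij_betw_step_rank[of n w] that by (simp add: bij_betw_def)
    then show ?thesis by force
  qed
  show "0 \<le> ?v j" if j: "j < ?k" for j
  proof -
    have "j < n" using j \<open>?k \<le> n\<close> by simp
    with obt obtain e where e: "e \<in> {1..n}" "step_rank n w e = Suc j" by blast
    have "step_rank n w e \<le> ?k" using e j by simp
    then have eL: "w (e - 1) \<le> L"
      unfolding step_rank_le_iff[OF e(1) n] L_def by auto
    have lb: "min (w n) (w (e - 1)) - min 0 (w (e - 1)) \<le> ?v j"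
      using quantile_transform_lower_bound(1)[OF w e(1)] e(2) by simp
    show ?thesis
    \<comment> \<open>Only here can the lower bound be negative. Then \<open>e\<close> starts at
      \<open>L\<close> and the last step of \<open>w\<close> goes down from \<open>L\<close>, so the
      strict bound applies and supplies the missing 1.\<close>
    proof (cases "w n < 0 \<and> w n < w (e - 1)")
      case True
      then have "w (e - 1) = L" "w n = L - 1" using wn eL by auto
      then have "min (w n) (w (e - 1)) - min 0 (w (e - 1)) < ?v j"
        using quantile_transform_lower_bound(2)[OF w e(1), of n] e by (simp add: L_def)
      then show ?thesis using \<open>w (e - 1) = L\<close> \<open>w n = L - 1\<close> True by (simp add: min_def split: if_splits)
    next
      case False
      then show ?thesis using lb by (auto simp: min_def split: if_splits)
    qed
  qed
  show "?v n < ?v j" if j: "?k \<le> j" "j < n" for j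
  proof -
    from j obt obtain e where e: "e \<in> {1..n}" "step_rank n w e = Suc j" by blast
    have "\<not> step_rank n w e \<le> ?k" using e j by simp
    then have eL: "L < w (e - 1)"
      unfolding step_rank_le_iff[OF e(1) n] L_def using e(1) by auto
    \<comment> \<open>The walk starts step \<open>e\<close> above \<open>L\<close> and is at
      \<open>L\<close> at time \<open>n - 1\<close>, so some step from \<open>e\<close> on leaves
      the level of \<open>e\<close> downwards; this gives strictness.\<close>
    have "w i - 1 \<le> w (Suc i)" if "i < n - 1" for i
      using simple_walk_Suc[OF w less_le_trans[OF that diff_le_self]] by auto
    then obtain i where i: "e - 1 \<le> i" "i < n - 1" "w i = w (e - 1)" "w (Suc i) = w (e - 1) - 1"
      by (rule last_exit[of "n - 1" w "e - 1" "w (e - 1)"]) (use e(1) eL L_def in auto)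
    have ei: "Suc i \<in> {e..n}" using i e(1) by auto
    have "min (w n) (w (e - 1)) - min 0 (w (e - 1)) < ?v j"
      using quantile_transform_lower_bound(2)[OF w e(1) ei] i e by simp
    then show ?thesis
      using eL wn quantile_transform_end[OF w] by (auto simp: min_def split: if_splits)
  qed
qed

section \<open>Recovering the walk: injectivity\<close>

text \<open>The step closing the nonempty block of \<open>a\<close> is the last exit from
  \<open>a\<close>; it goes down because the walk still has to reach the lower level
  \<open>w (n - 1)\<close>.\<close>

lemma quantile_transform_step_level_start_above:
  assumes w: "w \<in> simple_walks n"
    and a: "w (n - 1) < a" "level_start n w a < level_start n w (a + 1)"
  defines "v \<equiv> quantile_transform n w" and "t \<equiv> level_start n w (a + 1)"
  shows "v t - v (t - 1) = -1"
proof -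
  have "\<exists>e\<in>{1..n}. w (e - 1) = a"
  proof (rule ccontr)
    assume "\<not> (\<exists>e\<in>{1..n}. w (e - 1) = a)"
    then have "{i \<in> {1..n}. w (i - 1) < a + 1} = {i \<in> {1..n}. w (i - 1) < a}"
      unfolding zless_add1_eq by blast
    then show False using a(2) by (simp only: level_start_def less_irrefl)
  qed
  then obtain e where e: "e \<in> {1..n}" "w (e - 1) = a" by blast
  have "w i - 1 \<le> w (Suc i)" if "i < n - 1" for i
    using simple_walk_Suc[OF w less_le_trans[OF that diff_le_self]] by auto
  then obtain i where i: "i < n - 1" "w i = a" "w (Suc i) = a - 1"
    "\<And>j. i < j \<Longrightarrow> j \<le> n - 1 \<Longrightarrow> w j < a"
    by (rule last_exit[of "n - 1" w "e - 1" a]) (use e a in auto)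
  have "j - 1 \<le> i" if "j \<in> {1..n}" "w (j - 1) = a" for j
    using i(4)[of "j - 1"] that by force
  then have "step_rank n w (Suc i) = t"
    unfolding t_def using i(1,2) by (intro step_rank_last_visit) force+
  moreover have "Suc i \<in> {1..n}" using i by auto
  ultimately show ?thesis
    using quantile_transform_step[of "Suc i" n w] i unfolding v_def by simp
qed

text \<open>The last step in time to start below \<open>a\<close> goes from \<open>a - 1\<close> up
  to \<open>a\<close>, since the walk is at \<open>a\<close> or higher at time \<open>n - 1\<close>.
  Starting at the highest level below \<open>a\<close>, it is also last in key order.\<close>

lemma quantile_transform_step_level_start_below:
  assumes w: "w \<in> simple_walks n"
    and a: "a \<le> w (n - 1)" "0 < level_start n w a"
  defines "v \<equiv> quantile_transform n w" and "t \<equiv> level_start n w a"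
  shows "v t - v (t - 1) = 1"
proof -
  have "{i \<in> {1..n}. w (i - 1) < a} \<noteq> {}"
    using a(2) unfolding level_start_def card_gt_0_iff by blast
  then obtain e where e: "e \<in> {1..n}" "w (e - 1) < a" by blast
  \<comment> \<open>Reflecting the walk turns this ascent into an exit from level
    \<open>-(a - 1)\<close>.\<close>
  have "- w i - 1 \<le> - w (Suc i)" if "i < n - 1" for i
    using simple_walk_Suc[OF w less_le_trans[OF that diff_le_self]] by auto
  then obtain i where i: "i < n - 1" "- w i = - (a - 1)" "- w (Suc i) = - (a - 1) - 1"
    "\<And>j. i < j \<Longrightarrow> j \<le> n - 1 \<Longrightarrow> - w j < - (a - 1)"
    by (rule last_exit[of "n - 1" "\<lambda>i. - w i" "e - 1" "- (a - 1)"]) (use e a in auto)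
  have "j - 1 \<le> i" if "j \<in> {1..n}" "w (j - 1) < a" for j
    using i(4)[of "j - 1"] that by force
  then have "step_rank n w (Suc i) = t"
    unfolding t_def using i(1,2) by (intro step_rank_last_visit) force+
  moreover have "Suc i \<in> {1..n}" using i by auto
  ultimately show ?thesis
    using quantile_transform_step[of "Suc i" n w] i unfolding v_def by simp
qed

lemma step_rank_end:
  assumes "1 \<le> n"
  shows "step_rank n w n = level_start n w (w (n - 1) + 1)"
  using assms by (intro step_rank_last_visit) auto

text \<open>As \<open>v 0 = 0\<close>, the quantities are twice the numbers of up steps and of down
  steps so far.\<close>

lemma simple_walk_mono:
  assumes v: "v \<in> simple_walks n" and "i \<le> j" "j \<le> n"
  shows "v i + int i \<le> v j + int j" "int i - v i \<le> int j - v j"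
proof -
  have "v i + int i \<le> v j + int j \<and> int i - v i \<le> int j - v j"
    using assms(2,3)
  proof (induction j rule: dec_induct)
    case (step m)
    then show ?case using simple_walk_Suc[OF v, of m] by force
  qed simp
  then show "v i + int i \<le> v j + int j" "int i - v i \<le> int j - v j" by simp_all
qed

text \<open>The boundaries of the blocks of equal level are determined one after the other, starting from
  the end of the block that contains the last step of the walk. Upwards, the next block is known to
  end with a down step and its number of down steps is known; downwards, the number of up steps of
  the current block is known and the block below ends with an up step.\<close>

lemma level_start_above_unique:
  assumes w: "w \<in> simple_walks n" "w' \<in> simple_walks n"
    and v: "quantile_transform n w' = quantile_transform n w"
    and a: "w' (n - 1) < a" "level_start n w' a = level_start n w a"
  shows "\<not> level_start n w (a + 1) < level_start n w' (a + 1)"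
proof
  let ?v = "quantile_transform n w" and ?t = "level_start n w" and ?t' = "level_start n w'"
  assume less: "?t (a + 1) < ?t' (a + 1)"
  have "?t a \<le> ?t (a + 1)"
    unfolding level_start_def by (intro card_mono) auto
  then have "?t' a < ?t' (a + 1)" using less a(2) by linarith
  from quantile_transform_step_level_start_above[OF w(2) a(1) this]
  have "?v (?t' (a + 1)) - ?v (?t' (a + 1) - 1) = -1" unfolding v .
  \<comment> \<open>The down step at \<open>?t' (a + 1)\<close> makes the count of down steps there
    exceed that at \<open>?t (a + 1)\<close>, whereas the Tanaka identity forces equality.\<close>
  moreover have "int (?t (a + 1)) - ?v (?t (a + 1)) \<le> int (?t' (a + 1) - 1) - ?v (?t' (a + 1) - 1)"
    using less level_start_le[of n w' "a + 1"]
    by (intro simple_walk_mono(2)[OF quantile_transform_simple_walk[OF w(1)]]) auto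
  moreover have "w' n = w n" using w v by (metis quantile_transform_end)
  ultimately show False
    using quantile_transform_level_start[OF w(1), of a] quantile_transform_level_start[OF w(2), of a]
      a(2) less unfolding v by simp
qed

lemma level_start_below_unique:
  assumes w: "w \<in> simple_walks n" "w' \<in> simple_walks n"
    and v: "quantile_transform n w' = quantile_transform n w"
    and a: "a \<le> w' (n - 1)" "level_start n w' (a + 1) = level_start n w (a + 1)"
  shows "\<not> level_start n w a < level_start n w' a"
proof
  let ?v = "quantile_transform n w" and ?t = "level_start n w" and ?t' = "level_start n w'"
  assume less: "?t a < ?t' a"
  then have "0 < ?t' a" by simp
  from quantile_transform_step_level_start_below[OF w(2) a(1) this]
  have "?v (?t' a) - ?v (?t' a - 1) = 1" unfolding v .
  moreover have "?v (?t a) + int (?t a) \<le> ?v (?t' a - 1) + int (?t' a - 1)"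
    using less level_start_le[of n w' a]
    by (intro simple_walk_mono(1)[OF quantile_transform_simple_walk[OF w(1)]]) auto
  moreover have "w' n = w n" using w v by (metis quantile_transform_end)
  ultimately show False
    using quantile_transform_level_start[OF w(1), of a] quantile_transform_level_start[OF w(2), of a]
      a(2) less unfolding v by simp
qed

lemma quantile_transform_inj:
  assumes w: "w \<in> simple_walks n" "w' \<in> simple_walks n" and "1 \<le> n"
    and v: "quantile_transform n w' = quantile_transform n w"
    and k: "step_rank n w' n = step_rank n w n"
  shows "w' = w"
proof -
  have n: "n \<in> {1..n}" using assms(3) by simp
  have "w' n = w n" using w v by (metis quantile_transform_end)
  \<comment> \<open>The step of \<open>v\<close> at position \<open>k\<close> is the last step of
    \<open>w\<close>, and the endpoint is \<open>v n\<close>.\<close>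
  then have L: "w' (n - 1) = w (n - 1)"
    using quantile_transform_step[OF n, of w] quantile_transform_step[OF n, of w'] v k by simp
  let ?t = "level_start n w" and ?t' = "level_start n w'" and ?L = "w (n - 1)"
  have t0: "?t' (?L + 1) = ?t (?L + 1)"
    using step_rank_end[OF assms(3), of w] step_rank_end[OF assms(3), of w'] k L by simp
  \<comment> \<open>Each uniqueness lemma excludes one strict inequality, so it is used twice with
    the walks exchanged.\<close>
  have up: "?t' a = ?t a" if "?L + 1 \<le> a" for a
    using that
  proof (induction a rule: int_ge_induct)
    case (step a)
    then show ?case
      using level_start_above_unique[OF w v, of a]
        level_start_above_unique[OF w(2,1) v[symmetric], of a] L by simp
  qed (rule t0)
  have down: "?t' a = ?t a" if "a \<le> ?L + 1" for a
    using that
  proof (induction a rule: int_le_induct)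
    case (step a)
    then show ?case
      using level_start_below_unique[OF w v, of "a - 1"]
        level_start_below_unique[OF w(2,1) v[symmetric], of "a - 1"] L by simp
  qed (rule t0)
  have t: "?t' a = ?t a" for a
    using up[of a] down[of a] by linarith
  \<comment> \<open>The path up to time \<open>i\<close> and the boundaries give the position of
    step \<open>Suc i\<close> in \<open>v\<close>; there \<open>v\<close> shows its
    direction.\<close>
  have eq: "i \<le> n \<Longrightarrow> \<forall>j\<le>i. w' j = w j" for i
  proof (induction i)
    case 0
    then show ?case using w by (simp add: simple_walks_def)
  next
    case (Suc i)
    then have IH: "w' j = w j" if "j \<le> i" for j using that by simp
    have i: "Suc i \<in> {1..n}" using Suc.prems by simp
    have "{j \<in> {1..Suc i}. w' (j - 1) = w' i} = {j \<in> {1..Suc i}. w (j - 1) = w i}"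
      using IH by (intro Collect_cong) auto
    then have "step_rank n w' (Suc i) = step_rank n w (Suc i)"
      using step_rank_eq_level_start[OF i, of w] step_rank_eq_level_start[OF i, of w'] t IH[of i]
      by simp
    then have "w' (Suc i) = w (Suc i)"
      using quantile_transform_step[OF i, of w] quantile_transform_step[OF i, of w'] v IH[of i]
      by simp
    with IH show ?case by (auto simp: le_Suc_eq)
  qed
  show ?thesis
  proof
    fix i
    show "w' i = w i"
    proof (cases "i \<le> n")
      case True
      then show ?thesis using eq by blast
    next
      case False
      then show ?thesis using w by (auto simp: simple_walks_def PiE_def extensional_def)
    qed
  qed
qed

section \<open>Counting quantile pairs: surjectivity\<close>

lemma finite_simple_walks: "finite (simple_walks n)"
proof (rule finite_subset)
  show "simple_walks n \<subseteq> {0..n} \<rightarrow>\<^sub>E {- int n..int n}"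
  proof
    fix w assume w: "w \<in> simple_walks n"
    have "w i \<in> {- int n..int n}" if "i \<in> {0..n}" for i
      using simple_walk_mono[OF w, of 0 i] that w by (auto simp: simple_walks_def)
    with w show "w \<in> {0..n} \<rightarrow>\<^sub>E {- int n..int n}"
      by (auto simp: simple_walks_def PiE_def)
  qed
qed (simp add: finite_PiE)

text \<open>The steps of \<open>v\<close> after time \<open>k\<close> come first. For
  \<open>k \<le> n\<close> and \<open>v 0 = 0\<close> both formulas agree at the seam
  \<open>n - k\<close>.\<close>

definition cyclic_shift :: "nat \<Rightarrow> nat \<Rightarrow> (nat \<Rightarrow> int) \<Rightarrow> nat \<Rightarrow> int" where
  "cyclic_shift n k v =
    (\<lambda>i\<in>{0..n}. if i \<le> n - k then v (k + i) - v k else v (i - (n - k)) + v n - v k)"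

lemma cyclic_shift_simple_walk:
  assumes v: "v \<in> simple_walks n" and "k \<le> n"
  shows "cyclic_shift n k v \<in> simple_walks n"
proof -
  have v0: "v 0 = 0" using v by (simp add: simple_walks_def)
  have "cyclic_shift n k v i - cyclic_shift n k v (i - 1) \<in> {1, -1}" if i: "i \<in> {1..n}" for i
  proof (cases "i \<le> n - k")
    case True
    then have "k + i \<in> {1..n}" "k + (i - 1) = k + i - 1" using i by auto
    with True i simple_walk_step[OF v this(1)] show ?thesis by (auto simp: cyclic_shift_def)
  next
    case False
    define j where "j = i - (n - k)"
    have j: "j \<in> {1..n}" "j - 1 = i - 1 - (n - k)" using False i assms(2) by (auto simp: j_def)
    have "cyclic_shift n k v (i - 1) = v (j - 1) + v n - v k"
    proof (cases "i - 1 \<le> n - k")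
      case True
      then have "i - 1 = n - k" "j - 1 = 0" using False j by auto
      then show ?thesis using i v0 assms(2) by (simp add: cyclic_shift_def)
    next
      case False
      moreover have "i - 1 \<le> n" using i by auto
      ultimately show ?thesis using j by (simp add: cyclic_shift_def)
    qed
    moreover have "cyclic_shift n k v i = v j + v n - v k"
      using False i by (simp add: cyclic_shift_def j_def)
    ultimately show ?thesis using simple_walk_step[OF v j(1)] by auto
  qed
  moreover have "cyclic_shift n k v 0 = 0" by (simp add: cyclic_shift_def)
  ultimately show ?thesis by (auto simp: simple_walks_def cyclic_shift_def)
qed

text \<open>The analogue for walks of the Vervaat transform: the cut point of the shifted walk is the first
  time at which it attains its minimum over \<open>[0,n)\<close>.\<close>

lemma inj_on_cyclic_shift: "inj_on (\<lambda>(v, k). cyclic_shift n k v) (quantile_pairs n)"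
proof (rule inj_onI, clarify)
  fix v k v' k'
  assume p: "(v, k) \<in> quantile_pairs n" and p': "(v', k') \<in> quantile_pairs n"
    and eq: "cyclic_shift n k v = cyclic_shift n k' v'"
  \<comment> \<open>\<open>v n < v j\<close> on \<open>[k,n)\<close> gives strict inequality before
    \<open>n - k\<close>; \<open>0 \<le> v j\<close> for \<open>j < k\<close> gives the weak one
    from there on.\<close>
  have min: "cyclic_shift n k v (n - k) < cyclic_shift n k v i" if "i < n - k"
    "(v, k) \<in> quantile_pairs n" for v k i
    using that by (auto simp: quantile_pairs_def cyclic_shift_def)
  have min': "cyclic_shift n k v (n - k) \<le> cyclic_shift n k v i" if "n - k \<le> i" "i < n"
    "(v, k) \<in> quantile_pairs n" for v k i
    using that by (auto simp: quantile_pairs_def cyclic_shift_def)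
  have kn: "1 \<le> k" "k \<le> n" "1 \<le> k'" "k' \<le> n" using p p' by (auto simp: quantile_pairs_def)
  have "\<not> n - k < n - k'"
    using min[OF _ p', of "n - k"] min'[OF _ _ p, of "n - k'"] kn eq by fastforce
  moreover have "\<not> n - k' < n - k"
    using min[OF _ p, of "n - k'"] min'[OF _ _ p', of "n - k"] kn eq by fastforce
  ultimately have k: "k' = k" using kn by linarith
  have v: "v \<in> simple_walks n" "v' \<in> simple_walks n"
    using p p' by (auto simp: quantile_pairs_def quantile_walks_def)
  let ?c = "cyclic_shift n k"
  have lower: "u j = ?c u (n - k + j) - ?c u (n - k)"
    if "j \<le> k" "u \<in> simple_walks n" for u j
    using that kn by (cases "j = 0") (auto simp: cyclic_shift_def simple_walks_def)
  \<comment> \<open>\<open>?c u n - ?c u (n - k)\<close> equals \<open>u k\<close>, by which the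
    first piece was lowered.\<close>
  have upper: "u j = ?c u (j - k) + ?c u n - ?c u (n - k)"
    if "k \<le> j" "j \<le> n" "u \<in> simple_walks n" for u j
    using that kn by (auto simp: cyclic_shift_def)
  have "v i = v' i" for i
  proof -
    consider "i \<le> k" | "k \<le> i" "i \<le> n" | "n < i" by linarith
    then show ?thesis
    proof cases
      case 1
      then show ?thesis using lower[OF _ v(1)] lower[OF _ v(2)] eq k by simp
    next
      case 2
      then show ?thesis using upper[OF _ _ v(1)] upper[OF _ _ v(2)] eq k by simp
    next
      case 3
      then show ?thesis using v by (auto simp: simple_walks_def PiE_def extensional_def)
    qed
  qed
  then show "v = v' \<and> k = k'" using k by auto
qed

theorem theorem2p7:
  fixes n :: nat
  assumes "1 \<le> n"
  shows "bij_betw (\<lambda>w. (quantile_transform n w, inv (quantile_perm n w) n))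
           (simple_walks n) (quantile_pairs n)"
proof -
  let ?F = "\<lambda>w. (quantile_transform n w, inv (quantile_perm n w) n)"
  let ?G = "\<lambda>(v, k). cyclic_shift n k v"
  have rank: "inv (quantile_perm n w) n = step_rank n w n" for w
    using assms by (intro inv_quantile_perm) simp
  have inj: "inj_on ?F (simple_walks n)"
    unfolding rank using quantile_transform_inj[OF _ _ assms] by (auto intro!: inj_onI)
  have sub: "?F ` simple_walks n \<subseteq> quantile_pairs n"
    unfolding rank using quantile_transform_in_quantile_pairs[OF _ assms] by blast
  have G: "?G ` quantile_pairs n \<subseteq> simple_walks n"
    by (auto simp: quantile_pairs_def quantile_walks_def intro: cyclic_shift_simple_walk)
  have fin: "finite (quantile_pairs n)"
    using inj_on_cyclic_shift G finite_simple_walks by (rule inj_on_finite)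
  \<comment> \<open>The image of the injective \<open>?F\<close> is as large as the set of walks,
    and the shift bounds the number of pairs by that size.\<close>
  have "card (quantile_pairs n) \<le> card (?F ` simple_walks n)"
    using card_inj_on_le[OF inj_on_cyclic_shift G finite_simple_walks] by (simp add: card_image inj)
  with fin sub have "?F ` simple_walks n = quantile_pairs n" by (rule card_seteq)
  with inj show ?thesis by (simp add: bij_betw_def)
qed

end
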